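(* Let $m\geq 1$, let $\chi$ be a child distribution with finite $m$th moment, and let $\Psi$ be the automaton distribution map of the recursive tree system $(\chi,h)$. Then \begin{align*} \Psi^{(m)}(0) &= \sum_{\ell=m}^{\infty}(-1)^{m+h(\ell)}\binom{m-1}{h(\ell)-1}\chi(\ell)(\ell)_m\\ &= \sum_{j=1}^m (-1)^{m+j}\binom{m-1}{j-1}\sum_{\ell\in\mathrm{tier}(j)} \chi(\ell)(\ell)_m. \end{align*}
   Context: A child distribution $\chi$ is a probability measure on $\mathbb{N}=\{0,1,2,\ldots\}$; write $\chi(n)=\chi(\{n\})$. A recursive tree system $(\chi,h)$ consists of a child distribution $\chi$ and a threshold function $h\colon\mathbb{N}\to\{1,2,3,\ldots\}$ (so $h(\ell)\geq 1$ for all $\ell\geq 0$). Its automaton distribution map is $\Psi\colon[0,1]\to[0,1]$, $\Psi(x)=\sum_{\ell=0}^\infty \chi(\ell)\,\mathbb{P}[\mathrm{Bin}(\ell,x)\geq h(\ell)]$, where $\mathrm{Bin}(\ell,x)$ is a binomial random variable. Derivatives at $0$ are one-sided. The $k$th tier is $\mathrm{tier}(k)=\{\ell\geq 1\colon h(\ell)=k \text{ and } \chi(\ell)>0\}$. $(\ell)_m=\ell(\ell-1)\cdots(\ell-m+1)$ is the falling factorial. Conventions: $\binom{0}{0}=1$ and $\binom{n}{k}=0$ if $k>n$ or $k<0$. *)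

theory Defs
  imports "HOL-Probability.Probability"
begin

definition automaton_map :: "nat pmf \<Rightarrow> (nat \<Rightarrow> nat) \<Rightarrow> real \<Rightarrow> real" where
  "automaton_map chi h x =
     (\<Sum>\<^sub>\<infinity>l. pmf chi l * measure_pmf.prob (binomial_pmf l x) {h l..})"

definition tier :: "nat pmf \<Rightarrow> (nat \<Rightarrow> nat) \<Rightarrow> nat \<Rightarrow> nat set" where
  "tier chi h k = {l. 1 \<le> l \<and> h l = k \<and> 0 < pmf chi l}"

definition falling_fact :: "nat \<Rightarrow> nat \<Rightarrow> real" where
  "falling_fact l m = (\<Prod>i<m. real l - real i)"

definition has_finite_moment :: "nat pmf \<Rightarrow> nat \<Rightarrow> bool" where
  "has_finite_moment chi m \<longleftrightarrow> integrable (measure_pmf chi) (\<lambda>l. real l ^ m)"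

(* has_nth_derivative_within n f D x S: the n-th derivative of f, as a function with domain S,
   exists at x \<in> S and equals D. Existence at order n + 1 requires the n-th derivative g to
   exist on a neighbourhood of x in S and to be differentiable at x. Derivatives are relative
   to S, hence one-sided at an endpoint when S is an interval. *)
primrec has_nth_derivative_within ::
  "nat \<Rightarrow> (real \<Rightarrow> real) \<Rightarrow> real \<Rightarrow> real \<Rightarrow> real set \<Rightarrow> bool" where
  "has_nth_derivative_within 0 f D x S \<longleftrightarrow> f x = D"
| "has_nth_derivative_within (Suc n) f D x S \<longleftrightarrow>
     (\<exists>g. (\<forall>\<^sub>F y in nhds x. y \<in> S \<longrightarrow> has_nth_derivative_within n f (g y) y S) \<and>
          (g has_real_derivative D) (at x within S))"

lemma has_nth_derivative_within_unique:
  assumes S: "\<And>x. x \<in> S \<Longrightarrow> x islimpt S"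
    and "x \<in> S"
    and "has_nth_derivative_within n f D x S" "has_nth_derivative_within n f E x S"
  shows "D = E"
  using assms(2-4)
proof (induction n arbitrary: x D E)
  case 0
  then show ?case by simp
next
  case (Suc n)
  obtain g where g: "\<forall>\<^sub>F y in nhds x. y \<in> S \<longrightarrow> has_nth_derivative_within n f (g y) y S"
      "(g has_real_derivative D) (at x within S)"
    using Suc.prems(2) by auto
  obtain k where k: "\<forall>\<^sub>F y in nhds x. y \<in> S \<longrightarrow> has_nth_derivative_within n f (k y) y S"
      "(k has_real_derivative E) (at x within S)"
    using Suc.prems(3) by auto
  have eq: "\<forall>\<^sub>F y in nhds x. y \<in> S \<longrightarrow> g y = k y"
    using g(1) k(1) by eventually_elim (use Suc.IH in blast)
  have "g x = k x"
    using eventually_nhds_x_imp_x[OF eq] Suc.prems(1) by simp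
  moreover have "\<forall>\<^sub>F y in at x within S. g y = k y"
    unfolding eventually_at_filter using eq by eventually_elim simp
  ultimately have "(k has_real_derivative D) (at x within S)"
    using g(2) has_field_derivative_cong_eventually by blast
  moreover have "at x within S \<noteq> bot"
    using S Suc.prems(1) by (simp add: trivial_limit_within)
  ultimately show ?case
    using k(2) vector_derivative_unique_within has_real_derivative_iff_has_vector_derivative
    by blast
qed

end

theory Submission
  imports Defs
begin

text \<open>
  On \<open>[0,1]\<close> the map \<open>\<Psi>\<close> is a mixture \<open>\<Sum>l. \<chi>(l) T\<^sub>l(x)\<close> of polynomials, where
  \<open>T\<^sub>l(x) = 1 - (\<Sum>i<h(l). B\<^sub>l\<^sub>,\<^sub>i(x))\<close> is a binomial tail probability and the \<open>B\<^sub>l\<^sub>,\<^sub>i\<close> are the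
  Bernstein polynomials. The proof differentiates this series \<open>m\<close> times term by term.

  All derivatives follow from the difference rule
  \<open>B\<^sub>n\<^sub>,\<^sub>k' = n (B\<^sub>n\<^sub>-\<^sub>1\<^sub>,\<^sub>k\<^sub>-\<^sub>1 - B\<^sub>n\<^sub>-\<^sub>1\<^sub>,\<^sub>k)\<close>. For the tail the sum telescopes, so that
  \<open>T\<^sub>l' = l B\<^sub>l\<^sub>-\<^sub>1\<^sub>,\<^sub>h\<^sub>(\<^sub>l\<^sub>)\<^sub>-\<^sub>1\<close>; each further derivative produces the next factor of the falling
  factorial \<open>(l)\<^sub>m\<close> and one more finite difference in the lower index. This has two consequences.
  First, since \<open>0 \<le> B\<^sub>n\<^sub>,\<^sub>k \<le> 1\<close> on \<open>[0,1]\<close>, the \<open>r\<close>-th derivative of \<open>T\<^sub>l\<close> has modulus at most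
  \<open>2\<^sup>r (l)\<^sub>r\<close> there (\<open>abs_binomial_tail_deriv_le\<close>), and the finite \<open>m\<close>-th moment makes these bounds
  summable against \<open>\<chi>\<close> for every \<open>r \<le> m\<close>. The Weierstrass test then justifies the termwise
  differentiation up to the endpoint \<open>0\<close> (\<open>has_nth_derivative_within_series\<close>).
  Second, \<open>B\<^sub>n\<^sub>,\<^sub>k(0)\<close> is \<open>1\<close> for \<open>k = 0\<close> and \<open>0\<close> otherwise, so at \<open>0\<close> at most one term of the iterated
  difference survives, and its coefficient is the signed binomial coefficient in the formula
  (\<open>binomial_tail_deriv_at_0\<close>).

  The second form of the derivative groups the absolutely convergent series by the value
  of \<open>h\<close>; only the values \<open>1, \<dots>, m\<close> have a nonzero binomial coefficient.
\<close>

section \<open>Falling factorials\<close>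

lemma falling_fact_0 [simp]: "falling_fact l 0 = 1"
  by (simp add: falling_fact_def)

lemma falling_fact_Suc: "falling_fact l (Suc r) = real l * falling_fact (l - 1) r"
proof (cases l)
  case 0
  then show ?thesis by (simp add: falling_fact_def prod.lessThan_Suc_shift del: prod.lessThan_Suc)
next
  case (Suc n)
  then show ?thesis by (simp add: falling_fact_def prod.lessThan_Suc_shift del: prod.lessThan_Suc)
qed

lemma falling_fact_nonneg: "0 \<le> falling_fact l r"
  by (induction r arbitrary: l) (auto simp: falling_fact_Suc)

lemma falling_fact_le_power: "falling_fact l r \<le> real l ^ r"
proof (induction r arbitrary: l)
  case (Suc r)
  have "falling_fact (l - 1) r \<le> real (l - 1) ^ r"
    by (rule Suc.IH)
  also have "\<dots> \<le> real l ^ r"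
    by (rule power_mono) auto
  finally show ?case
    by (simp add: falling_fact_Suc mult_left_mono)
qed simp

lemma falling_fact_eq_0: "l < r \<Longrightarrow> falling_fact l r = 0"
  by (auto simp: falling_fact_def)

section \<open>Derivatives of Bernstein polynomials and of binomial tails\<close>

text \<open>
  The \<open>r\<close>-th derivative of the Bernstein polynomial, given by iterating the difference rule instead
  of in closed form, so that the uniform bound and the value at \<open>0\<close> are each one induction. The
  case \<open>k = 0\<close> is separate because \<open>B\<^sub>n\<^sub>,\<^sub>-\<^sub>1\<close> is \<open>0\<close>. For \<open>n = 0\<close> the factor \<open>n\<close> makes the truncated
  \<open>n - 1\<close> harmless.
\<close>
fun Bernstein_deriv :: "nat \<Rightarrow> nat \<Rightarrow> nat \<Rightarrow> real \<Rightarrow> real" where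
  "Bernstein_deriv 0 n k x = Bernstein n k x"
| "Bernstein_deriv (Suc r) n 0 x = - real n * Bernstein_deriv r (n - 1) 0 x"
| "Bernstein_deriv (Suc r) n (Suc k) x =
     real n * (Bernstein_deriv r (n - 1) k x - Bernstein_deriv r (n - 1) (Suc k) x)"

text \<open>
  The product rule leaves the coefficients \<open>k (n choose k)\<close> and \<open>(n - k) (n choose k)\<close>, and
  both absorb into \<open>n\<close> times a binomial coefficient of \<open>n - 1\<close>.
\<close>
lemma has_real_derivative_Bernstein:
  "(Bernstein n k has_real_derivative Bernstein_deriv (Suc 0) n k x) (at x within S)"
proof (cases k)
  case 0
  have "((\<lambda>x. (1 - x) ^ n) has_real_derivative - (real n * (1 - x) ^ (n - 1))) (at x within S)"
    by (auto intro!: derivative_eq_intros)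
  then show ?thesis
    by (simp add: 0 Bernstein_def[abs_def])
next
  case (Suc j)
  have p: "((\<lambda>x. x ^ k) has_real_derivative real k * x ^ j) (at x within S)"
    using DERIV_power[OF DERIV_ident, where n = k] by (simp add: Suc)
  have q: "((\<lambda>x. (1 - x) ^ (n - k)) has_real_derivative - (real (n - k) * (1 - x) ^ (n - k - 1)))
      (at x within S)"
    by (auto intro!: derivative_eq_intros)
  have d: "((\<lambda>x. real (n choose k) * (x ^ k * (1 - x) ^ (n - k))) has_real_derivative
        (real k * real (n choose k)) * x ^ j * (1 - x) ^ (n - k)
        - (real (n - k) * real (n choose k)) * x ^ k * (1 - x) ^ (n - k - 1)) (at x within S)"
    by (rule DERIV_cong[OF DERIV_cmult[OF DERIV_mult[OF p q]]]) (simp add: algebra_simps)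
  have a: "real k * real (n choose k) = real n * real ((n - 1) choose j)"
    using times_binomial_minus1_eq[of k n] Suc by (simp only: of_nat_mult[symmetric]) simp
  have b: "real (n - k) * real (n choose k) = real n * real ((n - 1) choose k)"
    using binomial_absorb_comp[of n k] by (simp flip: of_nat_mult)
  show ?thesis
    using d unfolding a b by (simp add: Suc Bernstein_def[abs_def] algebra_simps)
qed

lemma has_real_derivative_Bernstein_deriv:
  "(Bernstein_deriv r n k has_real_derivative Bernstein_deriv (Suc r) n k x) (at x within S)"
proof (induction r arbitrary: n k)
  case 0
  have "Bernstein_deriv 0 n k = Bernstein n k"
    by auto
  then show ?case
    using has_real_derivative_Bernstein by simp
next
  case (Suc r)
  show ?case
  proof (cases k)
    case 0
    have "Bernstein_deriv (Suc r) n 0 = (\<lambda>x. - real n * Bernstein_deriv r (n - 1) 0 x)"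
      by auto
    then show ?thesis
      unfolding 0 by (auto intro!: derivative_eq_intros Suc.IH)
  next
    case (Suc j)
    have "Bernstein_deriv (Suc r) n (Suc j) =
      (\<lambda>x. real n * (Bernstein_deriv r (n - 1) j x - Bernstein_deriv r (n - 1) (Suc j) x))"
      by auto
    then show ?thesis
      unfolding Suc by (auto intro!: derivative_eq_intros Suc.IH)
  qed
qed

lemma Bernstein_le_1:
  assumes "0 \<le> x" "x \<le> 1"
  shows "Bernstein n k x \<le> 1"
proof (cases "k \<le> n")
  case True
  have "Bernstein n k x \<le> (\<Sum>k\<le>n. Bernstein n k x)"
    by (rule member_le_sum) (use True assms in \<open>auto intro: Bernstein_nonneg\<close>)
  then show ?thesis by simp
qed (simp add: Bernstein_def binomial_eq_0)

text \<open>
  Up to the factor \<open>(n)\<^sub>r\<close> this is an \<open>r\<close>-fold difference: at most \<open>2\<^sup>r\<close> terms, each a signed Bernstein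
  polynomial of absolute value at most \<open>1\<close>.
\<close>
lemma abs_Bernstein_deriv_le:
  assumes "0 \<le> x" "x \<le> 1"
  shows "\<bar>Bernstein_deriv r n k x\<bar> \<le> 2 ^ r * falling_fact n r"
proof (induction r arbitrary: n k)
  case 0
  show ?case using Bernstein_nonneg[of x n k] Bernstein_le_1[of x n k] assms by auto
next
  case (Suc r)
  let ?c = "2 ^ r * falling_fact (n - 1) r"
  have c: "0 \<le> ?c" by (simp add: falling_fact_nonneg)
  show ?case
  proof (cases k)
    case 0
    have "\<bar>Bernstein_deriv r (n - 1) 0 x\<bar> \<le> 2 * ?c"
      using Suc.IH[of "n - 1" 0] c by linarith
    from mult_left_mono[OF this, of "real n"] show ?thesis
      by (simp add: 0 abs_mult falling_fact_Suc mult_ac)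
  next
    case (Suc j)
    have "\<bar>Bernstein_deriv r (n - 1) j x - Bernstein_deriv r (n - 1) (Suc j) x\<bar> \<le> 2 * ?c"
      using Suc.IH[of "n - 1" j] Suc.IH[of "n - 1" "Suc j"] by linarith
    from mult_left_mono[OF this, of "real n"] show ?thesis
      by (simp add: Suc abs_mult falling_fact_Suc mult_ac)
  qed
qed

text \<open>
  At \<open>0\<close> the difference rule turns into Pascal's rule for \<open>r choose k\<close>.
\<close>
lemma Bernstein_deriv_at_0:
  "Bernstein_deriv r n k 0 = (-1) ^ (r + k) * real (r choose k) * falling_fact n r"
proof (induction r arbitrary: n k)
  case 0
  show ?case by (cases k) (auto simp: Bernstein_def)
next
  case (Suc r)
  show ?case
    by (cases k) (simp_all add: Suc.IH falling_fact_Suc algebra_simps)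
qed

text \<open>
  The \<open>r\<close>-th derivative of the tail \<open>P[Bin(n,x) \<ge> k]\<close>, for \<open>k \<ge> 1\<close>. The tail is written through its
  complement, whose index range does not depend on \<open>n\<close> and whose derivative telescopes by
  induction on \<open>k\<close>.
\<close>
fun binomial_tail_deriv :: "nat \<Rightarrow> nat \<Rightarrow> nat \<Rightarrow> real \<Rightarrow> real" where
  "binomial_tail_deriv 0 n k x = 1 - (\<Sum>i<k. Bernstein n i x)"
| "binomial_tail_deriv (Suc r) n k x = real n * Bernstein_deriv r (n - 1) (k - 1) x"

lemma prob_binomial_tail:
  assumes "0 \<le> x" "x \<le> 1"
  shows "measure_pmf.prob (binomial_pmf n x) {k..} = binomial_tail_deriv 0 n k x"
proof -
  have "measure_pmf.prob (binomial_pmf n x) {k..} = 1 - measure_pmf.prob (binomial_pmf n x) {..<k}"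
    using measure_pmf.prob_compl[of "{..<k}" "binomial_pmf n x"]
    by (simp add: Compl_eq_Diff_UNIV[symmetric])
  also have "measure_pmf.prob (binomial_pmf n x) {..<k} = (\<Sum>i<k. Bernstein n i x)"
    using assms by (simp add: measure_measure_pmf_finite Bernstein_def)
  finally show ?thesis by simp
qed

text \<open>
  Only the first derivative needs the telescoping sum; the later ones are derivatives of
  a single Bernstein polynomial.
\<close>
lemma has_real_derivative_binomial_tail_deriv:
  assumes "1 \<le> k"
  shows "(binomial_tail_deriv r n k has_real_derivative binomial_tail_deriv (Suc r) n k x)
           (at x within S)"
proof (cases r)
  case 0
  have "((\<lambda>x. \<Sum>i<Suc j. Bernstein n i x) has_real_derivative - real n * Bernstein (n - 1) j x)
          (at x within S)" for j
  proof (induction j)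
    case 0
    show ?case using has_real_derivative_Bernstein[of n 0 x S] by simp
  next
    case (Suc j)
    from DERIV_add[OF Suc.IH has_real_derivative_Bernstein[of n "Suc j" x S]]
    show ?case by (simp add: algebra_simps)
  qed
  from DERIV_diff[OF DERIV_const[of 1] this[of "k - 1"]] assms
  have "((\<lambda>x. 1 - (\<Sum>i<k. Bernstein n i x)) has_real_derivative real n * Bernstein (n - 1) (k - 1) x)
          (at x within S)"
    by simp
  moreover have "binomial_tail_deriv 0 n k = (\<lambda>x. 1 - (\<Sum>i<k. Bernstein n i x))"
    by auto
  ultimately show ?thesis using 0 by simp
next
  case (Suc q)
  have "binomial_tail_deriv (Suc q) n k = (\<lambda>x. real n * Bernstein_deriv q (n - 1) (k - 1) x)"
    by auto
  then show ?thesis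
    unfolding Suc by (auto intro!: derivative_eq_intros has_real_derivative_Bernstein_deriv)
qed

lemma abs_binomial_tail_deriv_le:
  assumes "0 \<le> x" "x \<le> 1"
  shows "\<bar>binomial_tail_deriv r n k x\<bar> \<le> 2 ^ r * falling_fact n r"
proof (cases r)
  case 0
  have "0 \<le> binomial_tail_deriv 0 n k x" "binomial_tail_deriv 0 n k x \<le> 1"
    unfolding prob_binomial_tail[OF assms, symmetric] by simp_all
  with 0 show ?thesis by simp
next
  case (Suc q)
  have c: "0 \<le> 2 ^ q * falling_fact (n - 1) q" by (simp add: falling_fact_nonneg)
  have "\<bar>Bernstein_deriv q (n - 1) (k - 1) x\<bar> \<le> 2 * (2 ^ q * falling_fact (n - 1) q)"
    using abs_Bernstein_deriv_le[OF assms, of q "n - 1" "k - 1"] c by linarith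
  from mult_left_mono[OF this, of "real n"] show ?thesis
    by (simp add: Suc abs_mult falling_fact_Suc mult_ac)
qed

lemma binomial_tail_deriv_at_0:
  assumes "1 \<le> r" "1 \<le> k"
  shows "binomial_tail_deriv r n k 0 =
           (-1) ^ (r + k) * real ((r - 1) choose (k - 1)) * falling_fact n r"
proof -
  obtain q j where "r = Suc q" "k = Suc j"
    using assms by (metis One_nat_def Suc_le_D)
  then show ?thesis
    by (simp add: Bernstein_deriv_at_0 falling_fact_Suc)
qed

section \<open>Repeated differentiation of a series\<close>

text \<open>
  The Weierstrass test gives uniform convergence of the series of derivatives at each order.
  The candidate for the \<open>r\<close>-th derivative is the termwise series on all of \<open>S\<close>, so the neighbourhood
  required at the next order is the whole of \<open>S\<close>, even at an endpoint.
\<close>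
lemma has_nth_derivative_within_series:
  fixes f :: "nat \<Rightarrow> nat \<Rightarrow> real \<Rightarrow> real"
  assumes S: "convex S"
    and deriv: "\<And>r i x. r < m \<Longrightarrow> x \<in> S \<Longrightarrow> (f r i has_real_derivative f (Suc r) i x) (at x within S)"
    and bound: "\<And>r i x. r \<le> m \<Longrightarrow> x \<in> S \<Longrightarrow> \<bar>f r i x\<bar> \<le> M r i"
    and M: "\<And>r. r \<le> m \<Longrightarrow> summable (M r)"
    and F: "\<And>x. x \<in> S \<Longrightarrow> F x = (\<Sum>i. f 0 i x)"
    and "r \<le> m" "x \<in> S"
  shows "has_nth_derivative_within r F (\<Sum>i. f r i x) x S"
  using \<open>r \<le> m\<close> \<open>x \<in> S\<close>
proof (induction r arbitrary: x)
  case 0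
  then show ?case by (simp add: F)
next
  case (Suc r)
  have "uniform_limit S (\<lambda>n x. \<Sum>i<n. f (Suc r) i x) (\<lambda>x. \<Sum>i. f (Suc r) i x) sequentially"
    by (rule Weierstrass_m_test[where M = "M (Suc r)"]) (use Suc.prems bound M in auto)
  moreover have "summable (\<lambda>i. f r i x)"
    by (rule summable_comparison_test'[OF M[of r]]) (use Suc.prems bound in auto)
  ultimately obtain g where g: "\<And>y. y \<in> S \<Longrightarrow> (\<lambda>i. f r i y) sums g y"
      "\<And>y. y \<in> S \<Longrightarrow> (g has_real_derivative (\<Sum>i. f (Suc r) i y)) (at y within S)"
    using has_field_derivative_series[OF S, of "f r" "f (Suc r)"] deriv Suc.prems
    by (metis Suc_le_lessD)
  have "has_nth_derivative_within r F (g y) y S" if "y \<in> S" for y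
    using Suc.IH[of y] Suc.prems(1) that sums_unique[OF g(1)[OF that]] by simp
  with g(2)[OF Suc.prems(2)] show ?case
    by (auto intro!: always_eventually)
qed

section \<open>Finite sums of infinite sums\<close>

lemma has_sum_finite_sum:
  fixes f :: "'a \<Rightarrow> 'b \<Rightarrow> 'c :: topological_comm_monoid_add"
  assumes "finite A" "\<And>a. a \<in> A \<Longrightarrow> (f a has_sum s a) B"
  shows "((\<lambda>x. \<Sum>a\<in>A. f a x) has_sum (\<Sum>a\<in>A. s a)) B"
  using assms by (induction A rule: finite_induct) (auto intro!: has_sum_add)

section \<open>Derivatives of the automaton distribution map\<close>

text \<open>
  A finite \<open>m\<close>-th moment controls every lower order, as \<open>(l)\<^sub>r \<le> l\<^sup>r \<le> 1 + l\<^sup>m\<close>; the summand \<open>1\<close> covers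
  \<open>l = 0\<close>, where \<open>0\<^sup>0 = 1\<close>.
\<close>
lemma summable_pmf_falling_fact:
  assumes "has_finite_moment chi m" "r \<le> m"
  shows "summable (\<lambda>l. pmf chi l * falling_fact l r)"
proof -
  have "integrable (measure_pmf chi) (\<lambda>l. 1 + real l ^ m)"
    using assms(1) by (simp add: has_finite_moment_def)
  then have "integrable (count_space UNIV) (\<lambda>l. pmf chi l * (1 + real l ^ m))"
    by (simp add: measure_pmf_eq_density integrable_density)
  then have "summable (\<lambda>l. pmf chi l * (1 + real l ^ m))"
    by (simp add: integrable_count_space_nat_iff abs_mult)
  moreover have "norm (pmf chi l * falling_fact l r) \<le> pmf chi l * (1 + real l ^ m)" for l
  proof -
    have "falling_fact l r \<le> real l ^ r"
      by (rule falling_fact_le_power)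
    also have "\<dots> \<le> 1 + real l ^ m"
    proof (cases "l = 0")
      case False
      then have "real l ^ r \<le> real l ^ m"
        using assms(2) by (intro power_increasing) auto
      then show ?thesis by simp
    qed (simp add: power_0_left)
    finally show ?thesis
      by (simp add: abs_mult falling_fact_nonneg mult_left_mono)
  qed
  ultimately show ?thesis
    by (rule summable_comparison_test'[where N = 0])
qed

lemma has_nth_derivative_automaton_map:
  assumes threshold: "\<And>l. 1 \<le> h l"
    and moment: "has_finite_moment chi m"
    and r: "r \<le> m" and x: "x \<in> {0..1}"
  shows "has_nth_derivative_within r (automaton_map chi h)
           (\<Sum>l. pmf chi l * binomial_tail_deriv r l (h l) x) x {0..1}"
proof -
  define M where "M r l = pmf chi l * (2 ^ r * falling_fact l r)" for r l
  have bound: "\<bar>pmf chi l * binomial_tail_deriv r l (h l) x\<bar> \<le> M r l" if "x \<in> {0..1}" for r l x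
    using that unfolding M_def abs_mult
    by (auto intro!: mult_left_mono abs_binomial_tail_deriv_le)
  have M: "summable (M r)" if "r \<le> m" for r
    using summable_mult[OF summable_pmf_falling_fact[OF moment that], of "2 ^ r"]
    by (simp add: M_def[abs_def] mult_ac)
  have F: "automaton_map chi h x = (\<Sum>l. pmf chi l * binomial_tail_deriv 0 l (h l) x)"
    if "x \<in> {0..1}" for x
  proof -
    have s: "summable (\<lambda>l. norm (pmf chi l * binomial_tail_deriv 0 l (h l) x))"
      by (rule summable_comparison_test'[OF M[of 0]]) (use bound[OF that, of _ 0] in auto)
    show ?thesis
      unfolding automaton_map_def
      using infsumI[OF norm_summable_imp_has_sum[OF s summable_sums[OF summable_norm_cancel[OF s]]]]
        that
      by (simp add: prob_binomial_tail del: binomial_tail_deriv.simps)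
  qed
  show ?thesis
    by (rule has_nth_derivative_within_series[where m = m and M = M])
      (auto intro!: DERIV_cmult has_real_derivative_binomial_tail_deriv threshold F r
         M bound simp del: binomial_tail_deriv.simps simp: x[simplified])
qed

theorem theorem1p2:
  fixes chi :: "nat pmf" and h :: "nat \<Rightarrow> nat" and m :: nat
  assumes threshold: "\<And>l. 1 \<le> h l"
    and m: "1 \<le> m"
    and moment: "has_finite_moment chi m"
  shows "((\<lambda>l. (-1) ^ (m + h l) * real ((m - 1) choose (h l - 1)) * pmf chi l * falling_fact l m)
           summable_on {m..})
    \<and> (\<forall>j\<in>{1..m}. (\<lambda>l. pmf chi l * falling_fact l m) summable_on tier chi h j)
    \<and> (has_nth_derivative_within m (automaton_map chi h)
           (\<Sum>\<^sub>\<infinity>l\<in>{m..}. (-1) ^ (m + h l) * real ((m - 1) choose (h l - 1)) * pmf chi l * falling_fact l m)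
           0 {0..1})
    \<and> ((\<Sum>\<^sub>\<infinity>l\<in>{m..}. (-1) ^ (m + h l) * real ((m - 1) choose (h l - 1)) * pmf chi l * falling_fact l m)
         = (\<Sum>j = 1..m. (-1) ^ (m + j) * real ((m - 1) choose (j - 1)) *
              (\<Sum>\<^sub>\<infinity>l\<in>tier chi h j. pmf chi l * falling_fact l m)))"
proof -
  define w where "w l = pmf chi l * falling_fact l m" for l
  define c where "c j = (-1) ^ (m + j) * real ((m - 1) choose (j - 1))" for j
  have w_summable: "w summable_on A" for A
  proof -
    have "summable (\<lambda>l. norm (w l))"
      using summable_pmf_falling_fact[OF moment order_refl]
      by (simp add: w_def abs_mult falling_fact_nonneg)
    then show ?thesis
      using norm_summable_imp_summable_on summable_on_subset_banach by blast
  qed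
  have w_0: "w l = 0" if "l < m" for l
    using that by (simp add: w_def falling_fact_eq_0)
  have c_0: "c j = 0" if "m < j" for j
    using that m by (simp add: c_def)

  \<comment> \<open>An \<open>l\<close> in no tier has \<open>l = 0\<close> or \<open>\<chi>(l) = 0\<close>, so its weight \<open>w l\<close> vanishes.\<close>
  have by_tier: "c (h l) * w l = (\<Sum>j=1..m. c j * (if l \<in> tier chi h j then w l else 0))" for l
  proof -
    have "(if l \<in> tier chi h j then w l else 0) = (if j = h l then w l else 0)" for j
      using w_0[of l] m by (auto simp: tier_def w_def pmf_nonneg less_le)
    then have "(\<Sum>j=1..m. c j * (if l \<in> tier chi h j then w l else 0))
        = (\<Sum>j=1..m. if j = h l then c j * w l else 0)"
      by (intro sum.cong) auto
    also have "\<dots> = c (h l) * w l"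
      using threshold[of l] c_0[of "h l"] by auto
    finally show ?thesis by simp
  qed
  have tier_sum: "((\<lambda>l. if l \<in> tier chi h j then w l else 0) has_sum infsum w (tier chi h j)) UNIV"
    for j
    using has_sum_infsum[OF w_summable[of "tier chi h j"]]
    by (rule has_sum_cong_neutral[THEN iffD1, rotated -1]) auto
  have has_sum: "((\<lambda>l. c (h l) * w l) has_sum (\<Sum>j=1..m. c j * infsum w (tier chi h j))) UNIV"
    unfolding by_tier by (intro has_sum_finite_sum has_sum_cmult_right tier_sum) simp
  have has_sum': "((\<lambda>l. c (h l) * w l) has_sum (\<Sum>j=1..m. c j * infsum w (tier chi h j))) {m..}"
    using has_sum by (rule has_sum_cong_neutral[THEN iffD1, rotated -1]) (auto simp: w_0)

  have "(\<lambda>l. pmf chi l * binomial_tail_deriv m l (h l) 0) = (\<lambda>l. c (h l) * w l)"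
    using binomial_tail_deriv_at_0[OF m threshold] by (simp add: c_def w_def mult_ac)
  then have "has_nth_derivative_within m (automaton_map chi h) (\<Sum>l. c (h l) * w l) 0 {0..1}"
    using has_nth_derivative_automaton_map[of h, OF threshold moment order_refl, of 0] by simp
  moreover have "(\<Sum>l. c (h l) * w l) = (\<Sum>j=1..m. c j * infsum w (tier chi h j))"
    using has_sum_imp_sums[OF has_sum] by (simp add: sums_iff)
  moreover have "(\<lambda>l. c (h l) * w l) summable_on {m..}"
    using has_sum' by (auto simp: summable_on_def)
  moreover have "\<forall>j\<in>{1..m}. w summable_on tier chi h j"
    using w_summable by blast
  ultimately show ?thesis
    using infsumI[OF has_sum'] by (simp add: c_def w_def[abs_def] mult.assoc)
qed

end
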